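(* Let $x:[0,2\pi]\to\mathbb{R}^n$ be a smooth, regular, closed ($2\pi$-periodic) curve. (i) Let $\lambda>0$. If $x$ is a stationary point of $\mathcal{D}_\lambda=\mathcal{E}+\lambda\mathcal{D}$, then $x$ is parametrized by constant speed, $|x_u|\equiv S_x$ for a constant $S_x>0$, and $x$ is a stationary point of $\mathcal{E}_{\tilde\lambda}=\mathcal{E}+\tilde\lambda\mathcal{L}$ with $\tilde\lambda=\lambda S_x$. (ii) Let $\tilde\lambda>0$. If $x$ is a stationary point of $\mathcal{E}_{\tilde\lambda}$, then its reparametrization by constant speed, with speed denoted by $S_x$, is a stationary point of $\mathcal{D}_\lambda$ with $\lambda=\tilde\lambda/S_x$.
   Context: For a smooth regular closed curve $x=x(u)$, let $ds=|x_u|\,du$, $\partial_s=|x_u|^{-1}\partial_u$, and $\vec\kappa=\partial_s^2x$ the curvature vector. Define $\mathcal{E}(x)=\frac12\int_0^{2\pi}|\vec\kappa|^2ds$, $\mathcal{L}(x)=\int_0^{2\pi}|x_u|\,du$, $\mathcal{D}(x)=\frac12\int_0^{2\pi}|x_u|^2du$, $\mathcal{E}_{\tilde\lambda}=\mathcal{E}+\tilde\lambda\mathcal{L}$ and $\mathcal{D}_\lambda=\mathcal{E}+\lambda\mathcal{D}$. A curve is a stationary point of a functional if its first variation at that curve vanishes in the direction of every smooth $2\pi$-periodic vector field $\phi:[0,2\pi]\to\mathbb{R}^n$. The constant-speed reparametrization is over the same parameter interval $[0,2\pi]$. *)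

theory Defs
  imports "HOL-Analysis.Analysis"
begin

definition param_deriv :: "(real \<Rightarrow> 'a::real_normed_vector) \<Rightarrow> real \<Rightarrow> 'a" where
  "param_deriv f u = vector_derivative f (at u)"

definition smooth :: "(real \<Rightarrow> 'a::real_normed_vector) \<Rightarrow> bool" where
  "smooth f \<longleftrightarrow> (\<forall>k u. (param_deriv ^^ k) f differentiable (at u))"

text \<open>Closed curves, and vector fields along them, are represented by their \<open>2\<pi>\<close>-periodic
  extensions to the whole real line.\<close>

definition smooth_periodic :: "(real \<Rightarrow> 'a::real_normed_vector) \<Rightarrow> bool" where
  "smooth_periodic f \<longleftrightarrow> smooth f \<and> (\<forall>u. f (u + 2 * pi) = f u)"

definition regular_closed_curve :: "(real \<Rightarrow> real ^ 'n) \<Rightarrow> bool" where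
  "regular_closed_curve x \<longleftrightarrow> smooth_periodic x \<and> (\<forall>u. param_deriv x u \<noteq> 0)"

definition speed :: "(real \<Rightarrow> real ^ 'n) \<Rightarrow> real \<Rightarrow> real" where
  "speed x u = norm (param_deriv x u)"

definition arc_deriv :: "(real \<Rightarrow> real ^ 'n) \<Rightarrow> (real \<Rightarrow> real ^ 'n) \<Rightarrow> real \<Rightarrow> real ^ 'n" where
  "arc_deriv x f u = inverse (speed x u) *\<^sub>R param_deriv f u"

definition curvature_vec :: "(real \<Rightarrow> real ^ 'n) \<Rightarrow> real \<Rightarrow> real ^ 'n" where
  "curvature_vec x = arc_deriv x (arc_deriv x x)"

definition elastic_energy :: "(real \<Rightarrow> real ^ 'n) \<Rightarrow> real" where
  "elastic_energy x =
     1 / 2 * integral {0..2 * pi} (\<lambda>u. (norm (curvature_vec x u))\<^sup>2 * speed x u)"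

definition curve_length :: "(real \<Rightarrow> real ^ 'n) \<Rightarrow> real" where
  "curve_length x = integral {0..2 * pi} (speed x)"

definition dirichlet_energy :: "(real \<Rightarrow> real ^ 'n) \<Rightarrow> real" where
  "dirichlet_energy x = 1 / 2 * integral {0..2 * pi} (\<lambda>u. (speed x u)\<^sup>2)"

definition E_functional :: "real \<Rightarrow> (real \<Rightarrow> real ^ 'n) \<Rightarrow> real" where
  "E_functional lt x = elastic_energy x + lt * curve_length x"

definition D_functional :: "real \<Rightarrow> (real \<Rightarrow> real ^ 'n) \<Rightarrow> real" where
  "D_functional l x = elastic_energy x + l * dirichlet_energy x"

definition stationary_point :: "((real \<Rightarrow> real ^ 'n) \<Rightarrow> real) \<Rightarrow> (real \<Rightarrow> real ^ 'n) \<Rightarrow> bool" where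
  "stationary_point F x \<longleftrightarrow>
     (\<forall>\<phi>. smooth_periodic \<phi> \<longrightarrow>
        ((\<lambda>\<epsilon>. F (\<lambda>u. x u + \<epsilon> *\<^sub>R \<phi> u)) has_real_derivative 0) (at 0))"

text \<open>The conditions on \<open>\<theta>\<close> say that it extends an orientation-preserving diffeomorphism of
  \<open>[0, 2\<pi>]\<close> in such a way that it descends to the circle; fixing \<open>\<theta> 0 = 0\<close> keeps the base
  point of the curve.\<close>

definition constant_speed_reparam ::
    "(real \<Rightarrow> real ^ 'n) \<Rightarrow> (real \<Rightarrow> real ^ 'n) \<Rightarrow> real \<Rightarrow> bool" where
  "constant_speed_reparam x y S \<longleftrightarrow>
     (\<exists>\<theta>::real \<Rightarrow> real.
        smooth \<theta> \<and> (\<forall>u. param_deriv \<theta> u > 0) \<and>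
        \<theta> 0 = 0 \<and> (\<forall>u. \<theta> (u + 2 * pi) = \<theta> u + 2 * pi) \<and>
        y = x \<circ> \<theta>) \<and>
     (\<forall>u. speed y u = S)"

end

theory Submission
  imports Defs "HOL-Library.Periodic_Fun"
begin

text \<open>Both directions compare the first variations of length and Dirichlet energy. In the direction
  \<open>\<phi>\<close> they are \<open>\<integral> x' \<bullet> \<phi>' / |x'|\<close> and \<open>\<integral> x' \<bullet> \<phi>'\<close>, so along a curve of constant speed \<open>S\<close> the
  second is \<open>S\<close> times the first, and stationarity for \<open>\<E> + \<lambda> \<D>\<close> is the same as stationarity for
  \<open>\<E> + \<lambda> S \<L>\<close> (\<open>constant_speed_stationary_iff\<close>). It remains to reach constant speed.

  For (i) this follows from tangential test fields. The elastic energy does not depend on the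
  parametrization, so its first variation along \<open>\<psi> x'\<close> vanishes: infinitesimally, the integrand
  changes by \<open>(\<psi> F)'\<close>, where \<open>F\<close> is the energy density (\<open>elastic_variation_tangential\<close>).
  Stationarity therefore forces the Dirichlet part along \<open>\<psi> x'\<close> to vanish. With \<open>g = |x'|\<^sup>2\<close>,
  integration by parts turns that part into \<open>- 1/2 \<integral> \<psi> g'\<close>, and the choice \<open>\<psi> = g'\<close> gives \<open>g' = 0\<close>
  (\<open>stationary_D_constant_speed\<close>).

  For (ii), \<open>\<E>\<close> and \<open>\<L>\<close> are invariant under smooth changes of parameter \<open>\<theta>\<close> of the circle, and a
  variation \<open>\<phi>\<close> of \<open>x \<circ> \<theta>\<close> is the reparametrized variation \<open>\<phi> \<circ> \<theta>\<inverse>\<close> of \<open>x\<close>; so stationarity passes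
  from \<open>x\<close> to \<open>x \<circ> \<theta>\<close> (\<open>stationary_E_circle_lift\<close>). The parameter change that produces constant
  speed is the inverse of the normalized arc length, and it is the only one
  (\<open>constant_speed_reparam_exists_unique\<close>).\<close>

section \<open>Smooth functions of a real variable\<close>

text \<open>Smoothness is proved one order of differentiability at a time. The derivative of a product,
  a reciprocal, a norm or an inverse function is again built from such operations, applied to
  functions that are known to be differentiable one time less often; induction on the order
  therefore gives the closure properties of smooth functions.\<close>

primrec times_differentiable :: "nat \<Rightarrow> (real \<Rightarrow> 'a::real_normed_vector) \<Rightarrow> bool" where
  "times_differentiable 0 f \<longleftrightarrow> True"
| "times_differentiable (Suc n) f \<longleftrightarrow>
     (\<forall>u. f differentiable at u) \<and> times_differentiable n (param_deriv f)"

lemma times_differentiable_iff: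
  "times_differentiable n f \<longleftrightarrow> (\<forall>k<n. \<forall>u. (param_deriv ^^ k) f differentiable at u)"
  by (induction n arbitrary: f) (auto simp: less_Suc_eq_0_disj funpow_swap1)

lemma smooth_iff_times_differentiable: "smooth f \<longleftrightarrow> (\<forall>n. times_differentiable n f)"
  unfolding smooth_def times_differentiable_iff by blast

lemma has_param_deriv: "f differentiable at u \<Longrightarrow> (f has_vector_derivative param_deriv f u) (at u)"
  unfolding param_deriv_def by (rule vector_derivative_works[THEN iffD1])

lemma param_deriv_eqI: "(f has_vector_derivative f') (at u) \<Longrightarrow> param_deriv f u = f'"
  unfolding param_deriv_def by (rule vector_derivative_at)

lemma smooth_has_param_deriv: "smooth f \<Longrightarrow> (f has_vector_derivative param_deriv f u) (at u)"
  by (rule has_param_deriv) (metis smooth_def funpow_0)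

lemma smooth_param_deriv: "smooth f \<Longrightarrow> smooth (param_deriv f)"
  unfolding smooth_iff_times_differentiable by (metis times_differentiable.simps(2))

lemma smooth_continuous_on: "smooth f \<Longrightarrow> continuous_on A f"
  by (meson continuous_at_imp_continuous_on has_vector_derivative_continuous smooth_has_param_deriv)

lemma times_differentiable_SucI:
  assumes "\<And>u. (f has_vector_derivative f' u) (at u)" "times_differentiable n f'"
  shows "times_differentiable (Suc n) f"
proof -
  have "param_deriv f = f'"
    using assms(1) by (auto intro: param_deriv_eqI)
  with assms show ?thesis
    by (auto simp: has_vector_derivative_def intro: differentiableI)
qed

lemma times_differentiable_SucD: "times_differentiable (Suc n) f \<Longrightarrow> times_differentiable n f"
  by (simp add: times_differentiable_iff)

lemma times_differentiable_Suc_deriv: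
  "times_differentiable (Suc n) f \<Longrightarrow> (f has_vector_derivative param_deriv f u) (at u)"
  by (simp add: has_param_deriv)

lemma times_differentiable_const: "times_differentiable n (\<lambda>u. c)"
proof (induction n arbitrary: c)
  case (Suc n)
  show ?case by (rule times_differentiable_SucI[where f' = "\<lambda>u. 0"]) (auto intro: Suc)
qed simp

lemma times_differentiable_add:
  "times_differentiable n f \<Longrightarrow> times_differentiable n g \<Longrightarrow> times_differentiable n (\<lambda>u. f u + g u)"
proof (induction n arbitrary: f g)
  case (Suc n)
  show ?case
    by (rule times_differentiable_SucI[where f' = "\<lambda>u. param_deriv f u + param_deriv g u"])
      (use Suc in \<open>auto intro!: has_vector_derivative_add has_param_deriv\<close>)
qed simp

lemma times_differentiable_bilinear:
  assumes "bounded_bilinear pr"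
  shows "times_differentiable n f \<Longrightarrow> times_differentiable n g \<Longrightarrow>
    times_differentiable n (\<lambda>u. pr (f u) (g u))"
proof (induction n arbitrary: f g)
  case (Suc n)
  note f = Suc.prems(1) and g = Suc.prems(2)
  show ?case
  proof (rule times_differentiable_SucI)
    show "((\<lambda>u. pr (f u) (g u)) has_vector_derivative
            pr (f u) (param_deriv g u) + pr (param_deriv f u) (g u)) (at u)" for u
      using f g by (intro bounded_bilinear.has_vector_derivative[OF assms] has_param_deriv) auto
    show "times_differentiable n (\<lambda>u. pr (f u) (param_deriv g u) + pr (param_deriv f u) (g u))"
      using f g times_differentiable_SucD[OF f] times_differentiable_SucD[OF g]
      by (intro times_differentiable_add Suc.IH) auto
  qed
qed simp

lemma times_differentiable_compose:
  fixes \<theta> :: "real \<Rightarrow> real"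
  shows "times_differentiable n f \<Longrightarrow> times_differentiable n \<theta> \<Longrightarrow>
    times_differentiable n (\<lambda>u. f (\<theta> u))"
proof (induction n arbitrary: f)
  case (Suc n)
  note f = Suc.prems(1) and \<theta> = Suc.prems(2)
  show ?case
  proof (rule times_differentiable_SucI)
    show "((\<lambda>u. f (\<theta> u)) has_vector_derivative param_deriv \<theta> u *\<^sub>R param_deriv f (\<theta> u)) (at u)" for u
      using vector_diff_chain_at[OF has_param_deriv has_param_deriv, of \<theta> u f] f \<theta>
      by (simp add: o_def)
    show "times_differentiable n (\<lambda>u. param_deriv \<theta> u *\<^sub>R param_deriv f (\<theta> u))"
      using f \<theta> times_differentiable_SucD[OF \<theta>]
      by (intro times_differentiable_bilinear[OF bounded_bilinear_scaleR] Suc.IH) auto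
  qed
qed simp

lemma times_differentiable_inverse:
  fixes f :: "real \<Rightarrow> real"
  assumes "\<And>u. f u \<noteq> 0"
  shows "times_differentiable n f \<Longrightarrow> times_differentiable n (\<lambda>u. inverse (f u))"
proof (induction n)
  case (Suc n)
  note f = Suc.prems
  show ?case
  proof (rule times_differentiable_SucI)
    show "((\<lambda>u. inverse (f u)) has_vector_derivative
            (- 1) * (inverse (f u) * (param_deriv f u * inverse (f u)))) (at u)" for u
      using DERIV_inverse_fun[of f "param_deriv f u" u UNIV] times_differentiable_Suc_deriv[OF f] assms
      by (simp add: has_real_derivative_iff_has_vector_derivative mult_ac)
    show "times_differentiable n (\<lambda>u. (- 1) * (inverse (f u) * (param_deriv f u * inverse (f u))))"
      using f times_differentiable_SucD[OF f]
      by (intro times_differentiable_bilinear[OF bounded_bilinear_mult] times_differentiable_const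
          Suc.IH) auto
  qed
qed simp

lemma has_vector_derivative_norm:
  fixes f :: "real \<Rightarrow> 'a::real_inner"
  assumes "(f has_vector_derivative f') (at u)" "f u \<noteq> 0"
  shows "((\<lambda>u. norm (f u)) has_real_derivative inverse (norm (f u)) * (f u \<bullet> f')) (at u)"
proof -
  have "((\<lambda>u. norm (f u)) has_derivative (\<lambda>t. t *\<^sub>R f' \<bullet> sgn (f u))) (at u)"
    using has_derivative_compose[OF assms(1)[unfolded has_vector_derivative_def]
        has_derivative_norm[OF assms(2)]] .
  also have "(\<lambda>t. t *\<^sub>R f' \<bullet> sgn (f u)) = (*) (inverse (norm (f u)) * (f u \<bullet> f'))"
    by (simp add: fun_eq_iff sgn_div_norm inner_commute)
  finally show ?thesis
    by (simp add: has_field_derivative_def)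
qed

lemma times_differentiable_norm:
  fixes f :: "real \<Rightarrow> 'a::real_inner"
  assumes "\<And>u. f u \<noteq> 0"
  shows "times_differentiable n f \<Longrightarrow> times_differentiable n (\<lambda>u. norm (f u))"
proof (induction n)
  case (Suc n)
  note f = Suc.prems
  show ?case
  proof (rule times_differentiable_SucI)
    show "((\<lambda>u. norm (f u)) has_vector_derivative
            inverse (norm (f u)) * (f u \<bullet> param_deriv f u)) (at u)" for u
      using has_vector_derivative_norm[OF times_differentiable_Suc_deriv[OF f] assms]
      by (simp add: has_real_derivative_iff_has_vector_derivative)
    show "times_differentiable n (\<lambda>u. inverse (norm (f u)) * (f u \<bullet> param_deriv f u))"
      using f times_differentiable_SucD[OF f] assms
      by (intro times_differentiable_bilinear[OF bounded_bilinear_mult] Suc.IH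
          times_differentiable_bilinear[OF bounded_bilinear_inner] times_differentiable_inverse) auto
  qed
qed simp

text \<open>The derivative of \<open>\<eta>\<close> is an expression in \<open>\<eta>\<close> itself, so each order of differentiability of
  \<open>\<eta>\<close> yields the next one.\<close>

lemma times_differentiable_inverse_function:
  fixes \<theta> \<eta> :: "real \<Rightarrow> real"
  assumes "\<And>u. (\<eta> has_real_derivative inverse (param_deriv \<theta> (\<eta> u))) (at u)"
    "\<And>u. param_deriv \<theta> u \<noteq> 0" "smooth \<theta>"
  shows "times_differentiable n \<eta>"
proof (induction n)
  case (Suc n)
  show ?case
  proof (rule times_differentiable_SucI)
    show "(\<eta> has_vector_derivative inverse (param_deriv \<theta> (\<eta> u))) (at u)" for u
      using assms(1) by (simp add: has_real_derivative_iff_has_vector_derivative)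
    have "times_differentiable n (param_deriv \<theta>)"
      using smooth_param_deriv[OF assms(3)] by (simp add: smooth_iff_times_differentiable)
    then have "times_differentiable n (\<lambda>u. param_deriv \<theta> (\<eta> u))"
      using Suc by (rule times_differentiable_compose)
    then show "times_differentiable n (\<lambda>u. inverse (param_deriv \<theta> (\<eta> u)))"
      by (rule times_differentiable_inverse[OF assms(2)])
  qed
qed simp

lemma smooth_const: "smooth (\<lambda>u. c)"
  by (simp add: smooth_iff_times_differentiable times_differentiable_const)

lemma smooth_add: "smooth f \<Longrightarrow> smooth g \<Longrightarrow> smooth (\<lambda>u. f u + g u)"
  by (simp add: smooth_iff_times_differentiable times_differentiable_add)

lemma smooth_scaleR: "smooth f \<Longrightarrow> smooth g \<Longrightarrow> smooth (\<lambda>u. f u *\<^sub>R g u)"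
  by (simp add: smooth_iff_times_differentiable
      times_differentiable_bilinear[OF bounded_bilinear_scaleR])

lemma smooth_inner: "smooth f \<Longrightarrow> smooth g \<Longrightarrow> smooth (\<lambda>u. f u \<bullet> g u)"
  by (simp add: smooth_iff_times_differentiable
      times_differentiable_bilinear[OF bounded_bilinear_inner])

lemma smooth_compose: "smooth f \<Longrightarrow> smooth \<theta> \<Longrightarrow> smooth (\<lambda>u. f (\<theta> u))"
  by (simp add: smooth_iff_times_differentiable times_differentiable_compose)

lemma smooth_norm: 
  fixes f :: "real \<Rightarrow> 'a::real_inner"
  shows "smooth f \<Longrightarrow> (\<And>u. f u \<noteq> 0) \<Longrightarrow> smooth (\<lambda>u. norm (f u))"
  by (simp add: smooth_iff_times_differentiable times_differentiable_norm)

lemma smooth_antiderivative: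
  assumes "\<And>u. (f has_vector_derivative g u) (at u)" "smooth g"
  shows "smooth f"
  unfolding smooth_iff_times_differentiable
proof
  fix n show "times_differentiable n f"
    by (rule times_differentiable_SucD, rule times_differentiable_SucI[OF assms(1)])
      (use assms(2) in \<open>auto simp: smooth_iff_times_differentiable\<close>)
qed

lemma param_deriv_compose:
  fixes \<theta> :: "real \<Rightarrow> real"
  assumes "\<theta> differentiable at u" "f differentiable at (\<theta> u)"
  shows "param_deriv (\<lambda>u. f (\<theta> u)) u = param_deriv \<theta> u *\<^sub>R param_deriv f (\<theta> u)"
  using vector_diff_chain_at[OF has_param_deriv has_param_deriv, OF assms]
  by (intro param_deriv_eqI) (simp add: o_def)

lemma smooth_differentiable: "smooth f \<Longrightarrow> f differentiable at u"
  by (metis smooth_def funpow_0)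

lemma param_deriv_periodic:
  assumes "smooth f" "\<And>u. f (u + T) = f u"
  shows "param_deriv f (u + T) = param_deriv f u"
proof -
  have "((\<lambda>u. f (u + T)) has_vector_derivative param_deriv f (u + T)) (at u)"
    using vector_diff_chain_at[of "\<lambda>u. u + T" 1 u f "param_deriv f (u + T)"]
      smooth_has_param_deriv[OF assms(1), of "u + T"]
    by (simp add: o_def has_vector_derivative_add_const)
  moreover have "((\<lambda>u. f (u + T)) has_vector_derivative param_deriv f u) (at u)"
    unfolding assms(2) by (rule smooth_has_param_deriv[OF assms(1)])
  ultimately show ?thesis by (rule vector_derivative_unique_at)
qed

lemma smooth_periodic_param_deriv: "smooth_periodic f \<Longrightarrow> smooth_periodic (param_deriv f)"
  unfolding smooth_periodic_def
  using smooth_param_deriv[of f] param_deriv_periodic[of f "2 * pi"] by auto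

lemma smooth_continuous_on_compose:
  "smooth f \<Longrightarrow> continuous_on A g \<Longrightarrow> continuous_on A (\<lambda>z. f (g z))"
  by (rule continuous_on_compose2[of UNIV f]) (auto intro: smooth_continuous_on)

lemma smooth_product_deriv:
  assumes "smooth f" "smooth g"
  shows "param_deriv (\<lambda>u. f u *\<^sub>R g u) = (\<lambda>u. param_deriv f u *\<^sub>R g u + f u *\<^sub>R param_deriv g u)"
  using bounded_bilinear.has_vector_derivative[OF bounded_bilinear_scaleR
      smooth_has_param_deriv[OF assms(1)] smooth_has_param_deriv[OF assms(2)]]
  by (auto intro!: param_deriv_eqI simp: fun_eq_iff add.commute)

lemma periodic_representative:
  fixes f :: "real \<Rightarrow> 'a"
  assumes "\<And>u. f (u + T) = f u" "T > 0"
  obtains v where "v \<in> {0..T}" "f v = f u"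
proof -
  interpret periodic_fun_simple f T by unfold_locales (rule assms(1))
  have "f (u + of_int (- \<lfloor>u / T\<rfloor>) * T) = f u" by (rule plus_of_int)
  moreover have "of_int \<lfloor>u / T\<rfloor> * T \<le> u" "u \<le> (of_int \<lfloor>u / T\<rfloor> + 1) * T"
    using assms(2) by (auto simp flip: pos_le_divide_eq pos_divide_le_eq)
  ultimately show thesis
    by (intro that[of "u + of_int (- \<lfloor>u / T\<rfloor>) * T"]) (auto simp: algebra_simps)
qed

section \<open>First variations of length, Dirichlet and elastic energy\<close>

text \<open>Differentiation under the integral sign, for parameters near the unperturbed value \<open>0\<close>:
  the densities of length and elastic energy are smooth only as long as the perturbed curve stays
  regular.\<close>

lemma integral_variation:
  fixes F :: "real \<Rightarrow> real \<Rightarrow> real"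
  assumes "\<delta> > 0"
    and deriv: "\<And>\<epsilon> u. \<bar>\<epsilon>\<bar> < \<delta> \<Longrightarrow> u \<in> {a..b} \<Longrightarrow>
      ((\<lambda>\<epsilon>. F \<epsilon> u) has_real_derivative F' \<epsilon> u) (at \<epsilon>)"
    and cont: "\<And>\<epsilon>. \<bar>\<epsilon>\<bar> < \<delta> \<Longrightarrow> continuous_on {a..b} (F \<epsilon>)"
    and cont': "continuous_on ({-\<delta><..<\<delta>} \<times> {a..b}) (\<lambda>z. F' (fst z) (snd z))"
  shows "((\<lambda>\<epsilon>. integral {a..b} (F \<epsilon>)) has_real_derivative integral {a..b} (F' 0)) (at 0)"
proof -
  have "((\<lambda>\<epsilon>. integral (cbox a b) (F \<epsilon>)) has_real_derivative integral (cbox a b) (F' 0))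
      (at 0 within {-\<delta><..<\<delta>})"
  proof (rule leibniz_rule_field_derivative)
    show "((\<lambda>\<epsilon>. F \<epsilon> u) has_real_derivative F' \<epsilon> u) (at \<epsilon> within {-\<delta><..<\<delta>})"
      if "\<epsilon> \<in> {-\<delta><..<\<delta>}" "u \<in> cbox a b" for \<epsilon> u
      using deriv[of \<epsilon> u] that by (auto intro: has_field_derivative_at_within)
    show "F \<epsilon> integrable_on cbox a b" if "\<epsilon> \<in> {-\<delta><..<\<delta>}" for \<epsilon>
      using cont[of \<epsilon>] that by (auto intro!: integrable_continuous_real)
    show "continuous_on ({-\<delta><..<\<delta>} \<times> cbox a b) (\<lambda>(\<epsilon>, u). F' \<epsilon> u)"
      using cont' by (simp add: case_prod_unfold)
  qed (use assms(1) in auto)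
  then show ?thesis
    using assms(1) by (simp add: at_within_open[of 0 "{-\<delta><..<\<delta>}"])
qed

lemma integral_derivative_periodic:
  fixes f :: "real \<Rightarrow> real"
  assumes "\<And>u. u \<in> {a..b} \<Longrightarrow> (f has_real_derivative f' u) (at u)" "f a = f b" "a \<le> b"
  shows "integral {a..b} f' = 0"
proof -
  have "(f' has_integral f b - f a) {a..b}"
    using assms by (intro fundamental_theorem_of_calculus)
      (auto simp: has_real_derivative_iff_has_vector_derivative[symmetric]
        intro: has_field_derivative_at_within)
  then show ?thesis using assms(2) by (simp add: integral_unique)
qed

lemma param_deriv_perturbation:
  assumes "smooth x" "smooth \<phi>"
  shows "param_deriv (\<lambda>u. x u + \<epsilon> *\<^sub>R \<phi> u) = (\<lambda>u. param_deriv x u + \<epsilon> *\<^sub>R param_deriv \<phi> u)"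
proof
  fix u
  show "param_deriv (\<lambda>u. x u + \<epsilon> *\<^sub>R \<phi> u) u = param_deriv x u + \<epsilon> *\<^sub>R param_deriv \<phi> u"
    using smooth_has_param_deriv[OF assms(1)] smooth_has_param_deriv[OF assms(2)]
    by (intro param_deriv_eqI has_vector_derivative_add
        bounded_linear.has_vector_derivative[OF bounded_linear_scaleR_right])
qed

lemma smooth_perturbation:
  "smooth x \<Longrightarrow> smooth \<phi> \<Longrightarrow> smooth (\<lambda>u. x u + \<epsilon> *\<^sub>R \<phi> u)"
  by (intro smooth_add smooth_scaleR[OF smooth_const])

text \<open>By compactness the norm of \<open>p\<close> is bounded away from \<open>0\<close> and \<open>q\<close> is bounded.\<close>

lemma perturbation_nonzero:
  fixes p q :: "real \<Rightarrow> 'a::real_normed_vector"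
  assumes "continuous_on {a..b} p" "continuous_on {a..b} q" "a \<le> b"
    and nz: "\<And>u. u \<in> {a..b} \<Longrightarrow> p u \<noteq> 0"
  obtains \<delta> where "\<delta> > 0" "\<And>\<epsilon> u. \<bar>\<epsilon>\<bar> < \<delta> \<Longrightarrow> u \<in> {a..b} \<Longrightarrow> p u + \<epsilon> *\<^sub>R q u \<noteq> 0"
proof -
  obtain v where v: "v \<in> {a..b}" "\<And>u. u \<in> {a..b} \<Longrightarrow> norm (p v) \<le> norm (p u)"
    using continuous_attains_inf[OF compact_Icc _ continuous_on_norm[OF assms(1)]] assms(3)
    by (metis atLeastatMost_empty_iff2 not_less)
  obtain w where w: "w \<in> {a..b}" "\<And>u. u \<in> {a..b} \<Longrightarrow> norm (q u) \<le> norm (q w)"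
    using continuous_attains_sup[OF compact_Icc _ continuous_on_norm[OF assms(2)]] assms(3)
    by (metis atLeastatMost_empty_iff2 not_less)
  define \<delta> where "\<delta> = norm (p v) / (norm (q w) + 1)"
  have M: "norm (q w) + 1 > 0" by (simp add: add_nonneg_pos)
  show thesis
  proof
    show "\<delta> > 0" using nz[OF v(1)] M by (simp add: \<delta>_def)
    show "p u + \<epsilon> *\<^sub>R q u \<noteq> 0" if "\<bar>\<epsilon>\<bar> < \<delta>" "u \<in> {a..b}" for \<epsilon> u
    proof
      assume "p u + \<epsilon> *\<^sub>R q u = 0"
      then have "norm (p u) = norm (\<epsilon> *\<^sub>R q u)"
        by (metis add_eq_0_iff2 norm_minus_cancel)
      also have "\<dots> \<le> \<bar>\<epsilon>\<bar> * (norm (q w) + 1)"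
        using w(2)[OF that(2)] by (auto intro!: mult_left_mono)
      also have "\<dots> < norm (p v)"
        using that(1) M by (simp add: \<delta>_def pos_less_divide_eq)
      finally show False using v(2)[OF that(2)] by simp
    qed
  qed
qed

text \<open>The integrand \<open>|\<kappa>|\<^sup>2 |x'|\<close> of the elastic energy as a function of \<open>p = x'\<close> and \<open>P = x''\<close>; the
  numerator is the Gram determinant of \<open>p\<close> and \<open>P\<close>.\<close>

definition bending_density :: "'a::real_inner \<Rightarrow> 'a \<Rightarrow> real" where
  "bending_density p P = ((p \<bullet> p) * (P \<bullet> P) - (p \<bullet> P)\<^sup>2) / norm p ^ 5"

text \<open>The differential of the density at \<open>(p, P)\<close> in the direction \<open>(q, Q)\<close>.\<close>

definition bending_density_deriv :: "'a::real_inner \<Rightarrow> 'a \<Rightarrow> 'a \<Rightarrow> 'a \<Rightarrow> real" where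
  "bending_density_deriv p P q Q =
    (2 * (p \<bullet> q) * (P \<bullet> P) + 2 * (p \<bullet> p) * (P \<bullet> Q) - 2 * (p \<bullet> P) * (q \<bullet> P + p \<bullet> Q)) / norm p ^ 5
    - 5 * ((p \<bullet> p) * (P \<bullet> P) - (p \<bullet> P)\<^sup>2) * (p \<bullet> q) / norm p ^ 7"

lemma has_real_derivative_bending_density:
  fixes f g :: "real \<Rightarrow> 'a::real_inner"
  assumes f: "(f has_vector_derivative f') (at t)" and g: "(g has_vector_derivative g') (at t)"
    and nz: "f t \<noteq> 0"
  shows "((\<lambda>t. bending_density (f t) (g t)) has_real_derivative
    bending_density_deriv (f t) (g t) f' g') (at t)"
proof -
  have inner: "((\<lambda>t. h t \<bullet> k t) has_real_derivative h t \<bullet> k' + h' \<bullet> k t) (at t)"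
    if "(h has_vector_derivative h') (at t)" "(k has_vector_derivative k') (at t)"
    for h k :: "real \<Rightarrow> 'a" and h' k'
    unfolding has_real_derivative_iff_has_vector_derivative
    using bounded_bilinear.has_vector_derivative[OF bounded_bilinear_inner that] .
  define n where "n = norm (f t)"
  have n: "n \<noteq> 0" using nz by (simp add: n_def)
  show ?thesis
    unfolding bending_density_def
    apply (rule derivative_eq_intros inner[OF f f] inner[OF f g] inner[OF g g]
        has_vector_derivative_norm[OF f nz] refl)+
    using nz apply simp
    unfolding bending_density_deriv_def n_def[symmetric]
    using n by (simp add: field_simps inner_commute power2_eq_square eval_nat_numeral)
qed

text \<open>For \<open>p = x'\<close>, \<open>P = x''\<close>, \<open>R = P'\<close> and \<open>s, s1, s2 = \<psi>, \<psi>', \<psi>''\<close> the direction is formed by the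
  first two derivatives of the tangential field \<open>\<psi> x'\<close>, and the right-hand side is the derivative
  of \<open>\<psi>\<close> times the density. The \<open>s2\<close> term drops out because adding a multiple of \<open>p\<close> to \<open>P\<close> does
  not change the Gram determinant. The \<open>s1\<close> term scales \<open>p\<close> by \<open>1 + \<epsilon> s1\<close> and \<open>P\<close> by
  \<open>1 + 2 \<epsilon> s1\<close>, which contributes the factor \<open>2 + 4 - 5 = 1\<close>.\<close>

lemma bending_density_deriv_tangential:
  assumes "p \<noteq> 0"
  shows "bending_density_deriv p P (s1 *\<^sub>R p + s *\<^sub>R P) (s2 *\<^sub>R p + (2 * s1) *\<^sub>R P + s *\<^sub>R R) =
    s1 * bending_density p P + s * bending_density_deriv p P P R"
proof -
  define n where "n = norm p"
  have n: "n \<noteq> 0" "p \<bullet> p = n\<^sup>2" using assms by (auto simp: n_def dot_square_norm)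
  have n5: "inverse (n ^ 5) = n\<^sup>2 * inverse (n ^ 7)"
    using n(1) by (simp add: field_simps flip: power_add)
  show ?thesis
    unfolding bending_density_def bending_density_deriv_def n_def[symmetric] divide_inverse n5
    by (simp add: n(2) inner_simps inner_commute[of P p]) (simp add: algebra_simps power2_eq_square)
qed

lemma curvature_density:
  fixes z :: "real \<Rightarrow> real ^ 'n"
  assumes z: "smooth z" and nz: "param_deriv z u \<noteq> 0"
  shows "(norm (curvature_vec z u))\<^sup>2 * speed z u =
    bending_density (param_deriv z u) (param_deriv (param_deriv z) u)"
proof -
  define p P where "p = param_deriv z" and "P = param_deriv p u"
  define n where "n = norm (p u)"
  have n: "n \<noteq> 0" "p u \<bullet> p u = n\<^sup>2" using nz by (auto simp: n_def p_def dot_square_norm)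
  have p: "(p has_vector_derivative P) (at u)"
    unfolding P_def p_def using z by (intro smooth_has_param_deriv smooth_param_deriv)
  have "((\<lambda>u. inverse (norm (p u))) has_real_derivative
      - (inverse n * (inverse n * (p u \<bullet> P)) * inverse n)) (at u)"
    using DERIV_inverse'[OF has_vector_derivative_norm[OF p]] nz by (simp add: p_def n_def)
  then have "((\<lambda>u. inverse (norm (p u)) *\<^sub>R p u) has_vector_derivative
      inverse n *\<^sub>R P + (- (inverse n * (inverse n * (p u \<bullet> P)) * inverse n)) *\<^sub>R p u) (at u)"
    unfolding n_def by (rule has_vector_derivative_scaleR[OF _ p])
  moreover have "arc_deriv z z = (\<lambda>u. inverse (norm (p u)) *\<^sub>R p u)"
    by (simp add: fun_eq_iff arc_deriv_def speed_def p_def)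
  ultimately have "param_deriv (arc_deriv z z) u =
      inverse n *\<^sub>R P + (- (inverse n * (inverse n * (p u \<bullet> P)) * inverse n)) *\<^sub>R p u"
    by (simp only: param_deriv_eqI)
  then have \<kappa>: "curvature_vec z u = inverse n *\<^sub>R
      (inverse n *\<^sub>R P + (- (inverse n * (inverse n * (p u \<bullet> P)) * inverse n)) *\<^sub>R p u)"
    by (simp only: curvature_vec_def arc_deriv_def[of z "arc_deriv z z" u] speed_def n_def p_def)
  show ?thesis
    unfolding power2_norm_eq_inner \<kappa> speed_def bending_density_def p_def[symmetric] P_def[symmetric]
      n_def[symmetric]
    using n by (simp add: inner_simps inner_commute[of P "p u"] divide_simps)
      (simp add: algebra_simps eval_nat_numeral)
qed

lemma has_vector_derivative_line:
  "((\<lambda>\<epsilon>. a + \<epsilon> *\<^sub>R b) has_vector_derivative b) (at \<epsilon>)"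
  by (auto intro!: derivative_eq_intros simp: has_vector_derivative_def)

lemma regular_perturbation:
  assumes "regular_closed_curve x" "smooth \<phi>"
  obtains \<delta> where "\<delta> > 0" "\<And>\<epsilon> u. \<bar>\<epsilon>\<bar> < \<delta> \<Longrightarrow> u \<in> {0..2 * pi} \<Longrightarrow>
    param_deriv x u + \<epsilon> *\<^sub>R param_deriv \<phi> u \<noteq> 0"
proof (rule perturbation_nonzero)
  show "continuous_on {0..2 * pi} (param_deriv x)" "continuous_on {0..2 * pi} (param_deriv \<phi>)"
    using assms by (auto simp: regular_closed_curve_def smooth_periodic_def
        intro: smooth_continuous_on smooth_param_deriv)
qed (use assms(1) in \<open>auto simp: regular_closed_curve_def\<close>)

lemma length_variation:
  assumes x: "regular_closed_curve x" and \<phi>: "smooth \<phi>"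
  shows "((\<lambda>\<epsilon>. curve_length (\<lambda>u. x u + \<epsilon> *\<^sub>R \<phi> u)) has_real_derivative
    integral {0..2 * pi} (\<lambda>u. (param_deriv x u \<bullet> param_deriv \<phi> u) / speed x u)) (at 0)"
proof -
  define p q where "p = param_deriv x" and "q = param_deriv \<phi>"
  have sx: "smooth x" using x by (simp add: regular_closed_curve_def smooth_periodic_def)
  have pq: "smooth p" "smooth q" using sx \<phi> by (auto simp: p_def q_def intro: smooth_param_deriv)
  note cont = smooth_continuous_on_compose[OF pq(1)] smooth_continuous_on_compose[OF pq(2)]
  obtain \<delta> where \<delta>: "\<delta> > 0"
    "\<And>\<epsilon> u. \<bar>\<epsilon>\<bar> < \<delta> \<Longrightarrow> u \<in> {0..2 * pi} \<Longrightarrow> p u + \<epsilon> *\<^sub>R q u \<noteq> 0"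
    using regular_perturbation[OF x \<phi>] unfolding p_def q_def by blast
  have "((\<lambda>\<epsilon>. integral {0..2 * pi} (\<lambda>u. norm (p u + \<epsilon> *\<^sub>R q u))) has_real_derivative
    integral {0..2 * pi} (\<lambda>u. inverse (norm (p u + 0 *\<^sub>R q u)) * ((p u + 0 *\<^sub>R q u) \<bullet> q u))) (at 0)"
  proof (rule integral_variation[OF \<delta>(1)])
    show "((\<lambda>\<epsilon>. norm (p u + \<epsilon> *\<^sub>R q u)) has_real_derivative
        inverse (norm (p u + \<epsilon> *\<^sub>R q u)) * ((p u + \<epsilon> *\<^sub>R q u) \<bullet> q u)) (at \<epsilon>)"
      if "\<bar>\<epsilon>\<bar> < \<delta>" "u \<in> {0..2 * pi}" for \<epsilon> u
      using that by (intro has_vector_derivative_norm has_vector_derivative_line \<delta>(2))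
    show "continuous_on {0..2 * pi} (\<lambda>u. norm (p u + \<epsilon> *\<^sub>R q u))" for \<epsilon>
      by (intro continuous_intros cont)
    show "continuous_on ({- \<delta><..<\<delta>} \<times> {0..2 * pi}) (\<lambda>z.
        inverse (norm (p (snd z) + fst z *\<^sub>R q (snd z))) *
          ((p (snd z) + fst z *\<^sub>R q (snd z)) \<bullet> q (snd z)))"
      by (intro continuous_intros cont ballI) (use \<delta>(2) in auto)
  qed
  then show ?thesis
    by (simp add: curve_length_def speed_def[abs_def] param_deriv_perturbation[OF sx \<phi>]
        divide_inverse mult.commute flip: p_def q_def)
qed

lemma dirichlet_variation:
  assumes sx: "smooth x" and \<phi>: "smooth \<phi>"
  shows "((\<lambda>\<epsilon>. dirichlet_energy (\<lambda>u. x u + \<epsilon> *\<^sub>R \<phi> u)) has_real_derivative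
    integral {0..2 * pi} (\<lambda>u. param_deriv x u \<bullet> param_deriv \<phi> u)) (at 0)"
proof -
  define p q where "p = param_deriv x" and "q = param_deriv \<phi>"
  have pq: "smooth p" "smooth q" using sx \<phi> by (auto simp: p_def q_def intro: smooth_param_deriv)
  note cont = smooth_continuous_on_compose[OF pq(1)] smooth_continuous_on_compose[OF pq(2)]
  have "((\<lambda>\<epsilon>. integral {0..2 * pi} (\<lambda>u. (norm (p u + \<epsilon> *\<^sub>R q u))\<^sup>2)) has_real_derivative
    integral {0..2 * pi} (\<lambda>u. 2 * ((p u + 0 *\<^sub>R q u) \<bullet> q u))) (at 0)"
  proof (rule integral_variation[of 1])
    show "((\<lambda>\<epsilon>. (norm (p u + \<epsilon> *\<^sub>R q u))\<^sup>2) has_real_derivative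
        2 * ((p u + \<epsilon> *\<^sub>R q u) \<bullet> q u)) (at \<epsilon>)" for \<epsilon> u
      using bounded_bilinear.has_vector_derivative[OF bounded_bilinear_inner
          has_vector_derivative_line[of "p u" "q u" \<epsilon>] has_vector_derivative_line[of "p u" "q u" \<epsilon>]]
      by (simp add: power2_norm_eq_inner has_real_derivative_iff_has_vector_derivative inner_commute)
    show "continuous_on {0..2 * pi} (\<lambda>u. (norm (p u + \<epsilon> *\<^sub>R q u))\<^sup>2)" for \<epsilon>
      by (intro continuous_intros cont)
    show "continuous_on ({- 1<..<1} \<times> {0..2 * pi}) (\<lambda>z.
        2 * ((p (snd z) + fst z *\<^sub>R q (snd z)) \<bullet> q (snd z)))"
      by (intro continuous_intros cont)
  qed simp
  from DERIV_cmult[OF this, of "1/2"] show ?thesis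
    by (simp add: dirichlet_energy_def speed_def[abs_def] param_deriv_perturbation[OF sx \<phi>]
        flip: p_def q_def)
qed

lemma elastic_energy_eq:
  fixes z :: "real \<Rightarrow> real ^ 'n"
  assumes "smooth z" "\<And>u. u \<in> {0..2 * pi} \<Longrightarrow> param_deriv z u \<noteq> 0"
  shows "elastic_energy z = 1 / 2 * integral {0..2 * pi}
    (\<lambda>u. bending_density (param_deriv z u) (param_deriv (param_deriv z) u))"
  unfolding elastic_energy_def
  by (intro arg_cong2[where f = "(*)"] refl integral_cong curvature_density assms)

lemma elastic_variation:
  assumes x: "regular_closed_curve x" and \<phi>: "smooth \<phi>"
  shows "((\<lambda>\<epsilon>. elastic_energy (\<lambda>u. x u + \<epsilon> *\<^sub>R \<phi> u)) has_real_derivative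
    1 / 2 * integral {0..2 * pi} (\<lambda>u. bending_density_deriv
      (param_deriv x u) (param_deriv (param_deriv x) u)
      (param_deriv \<phi> u) (param_deriv (param_deriv \<phi>) u))) (at 0)"
proof -
  define p q P Q where "p = param_deriv x" and "q = param_deriv \<phi>"
    and "P = param_deriv p" and "Q = param_deriv q"
  have sx: "smooth x" using x by (simp add: regular_closed_curve_def smooth_periodic_def)
  have pq: "smooth p" "smooth q" using sx \<phi> by (auto simp: p_def q_def intro: smooth_param_deriv)
  then have PQ: "smooth P" "smooth Q" by (auto simp: P_def Q_def intro: smooth_param_deriv)
  note cont = smooth_continuous_on_compose[OF pq(1)] smooth_continuous_on_compose[OF pq(2)]
    smooth_continuous_on_compose[OF PQ(1)] smooth_continuous_on_compose[OF PQ(2)]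
  obtain \<delta> where \<delta>: "\<delta> > 0"
    "\<And>\<epsilon> u. \<bar>\<epsilon>\<bar> < \<delta> \<Longrightarrow> u \<in> {0..2 * pi} \<Longrightarrow> p u + \<epsilon> *\<^sub>R q u \<noteq> 0"
    using regular_perturbation[OF x \<phi>] unfolding p_def q_def by blast
  let ?B = "\<lambda>\<epsilon> u. bending_density (p u + \<epsilon> *\<^sub>R q u) (P u + \<epsilon> *\<^sub>R Q u)"
  have "((\<lambda>\<epsilon>. integral {0..2 * pi} (?B \<epsilon>)) has_real_derivative integral {0..2 * pi}
      (\<lambda>u. bending_density_deriv (p u + 0 *\<^sub>R q u) (P u + 0 *\<^sub>R Q u) (q u) (Q u))) (at 0)"
  proof (rule integral_variation[OF \<delta>(1)])
    show "((\<lambda>\<epsilon>. ?B \<epsilon> u) has_real_derivative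
        bending_density_deriv (p u + \<epsilon> *\<^sub>R q u) (P u + \<epsilon> *\<^sub>R Q u) (q u) (Q u)) (at \<epsilon>)"
      if "\<bar>\<epsilon>\<bar> < \<delta>" "u \<in> {0..2 * pi}" for \<epsilon> u
      using that by (intro has_real_derivative_bending_density has_vector_derivative_line \<delta>(2))
    show "continuous_on {0..2 * pi} (?B \<epsilon>)" if "\<bar>\<epsilon>\<bar> < \<delta>" for \<epsilon>
      unfolding bending_density_def
      by (intro continuous_intros cont ballI) (use \<delta>(2) that in auto)
    show "continuous_on ({- \<delta><..<\<delta>} \<times> {0..2 * pi}) (\<lambda>z.
        bending_density_deriv (p (snd z) + fst z *\<^sub>R q (snd z)) (P (snd z) + fst z *\<^sub>R Q (snd z))
          (q (snd z)) (Q (snd z)))"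
      unfolding bending_density_deriv_def
      by (intro continuous_intros cont ballI) (use \<delta>(2) in auto)
  qed
  from DERIV_cmult[OF this, of "1/2"]
  have "((\<lambda>\<epsilon>. 1 / 2 * integral {0..2 * pi} (?B \<epsilon>)) has_real_derivative 1 / 2 * integral {0..2 * pi}
      (\<lambda>u. bending_density_deriv (p u) (P u) (q u) (Q u))) (at 0)"
    by simp
  moreover have "1 / 2 * integral {0..2 * pi} (?B \<epsilon>) = elastic_energy (\<lambda>u. x u + \<epsilon> *\<^sub>R \<phi> u)"
    if "\<epsilon> \<in> {-\<delta><..<\<delta>}" for \<epsilon>
    using that \<delta>(2)
    by (subst elastic_energy_eq) (auto simp: param_deriv_perturbation[OF sx \<phi>]
        param_deriv_perturbation[OF pq] smooth_perturbation[OF sx \<phi>] P_def Q_def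
        simp flip: p_def q_def)
  ultimately show ?thesis
    using \<delta>(1) unfolding p_def[symmetric] q_def[symmetric] P_def[symmetric] Q_def[symmetric]
    by (auto intro: has_field_derivative_transform_within_open[where S = "{-\<delta><..<\<delta>}"])
qed

text \<open>This expresses the invariance of the elastic energy under reparametrization, without the flow
  of the field: the variation of the integrand is a total derivative of a periodic function.\<close>

lemma elastic_variation_tangential:
  assumes x: "regular_closed_curve x" and \<psi>: "smooth_periodic \<psi>"
  shows "((\<lambda>\<epsilon>. elastic_energy (\<lambda>u. x u + \<epsilon> *\<^sub>R \<psi> u *\<^sub>R param_deriv x u)) has_real_derivative 0) (at 0)"
proof -
  define p P R where "p = param_deriv x" and "P = param_deriv p" and "R = param_deriv P"
  define q where "q = param_deriv (\<lambda>u. \<psi> u *\<^sub>R p u)"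
  have sx: "smooth x" using x by (simp add: regular_closed_curve_def smooth_periodic_def)
  have sp: "smooth \<psi>" "smooth (param_deriv \<psi>)"
    using \<psi> by (auto simp: smooth_periodic_def intro: smooth_param_deriv)
  have p: "smooth p" "smooth P" using sx by (auto simp: p_def P_def intro: smooth_param_deriv)
  have nz: "p u \<noteq> 0" for u using x by (simp add: p_def regular_closed_curve_def)
  have q: "q = (\<lambda>u. param_deriv \<psi> u *\<^sub>R p u + \<psi> u *\<^sub>R P u)"
    unfolding q_def P_def by (rule smooth_product_deriv[OF sp(1) p(1)])
  have Q: "param_deriv q u = param_deriv (param_deriv \<psi>) u *\<^sub>R p u
      + (2 * param_deriv \<psi> u) *\<^sub>R P u + \<psi> u *\<^sub>R R u" for u
  proof (rule param_deriv_eqI)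
    show "(q has_vector_derivative param_deriv (param_deriv \<psi>) u *\<^sub>R p u
      + (2 * param_deriv \<psi> u) *\<^sub>R P u + \<psi> u *\<^sub>R R u) (at u)"
      using has_vector_derivative_add[OF
        bounded_bilinear.has_vector_derivative[OF bounded_bilinear_scaleR
          smooth_has_param_deriv[OF sp(2)] smooth_has_param_deriv[OF p(1)]]
        bounded_bilinear.has_vector_derivative[OF bounded_bilinear_scaleR
          smooth_has_param_deriv[OF sp(1)] smooth_has_param_deriv[OF p(2)]], of u]
      by (simp add: q P_def R_def algebra_simps scaleR_2 flip: scaleR_scaleR)
  qed
  have density: "((\<lambda>u. bending_density (p u) (P u)) has_real_derivative
      bending_density_deriv (p u) (P u) (P u) (R u)) (at u)" for u
    unfolding P_def R_def
    by (intro has_real_derivative_bending_density smooth_has_param_deriv p[unfolded P_def] nz)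
  have "integral {0..2 * pi} (\<lambda>u. bending_density_deriv (p u) (P u) (q u) (param_deriv q u)) = 0"
  proof (rule integral_derivative_periodic)
    show "((\<lambda>u. \<psi> u * bending_density (p u) (P u)) has_real_derivative
        bending_density_deriv (p u) (P u) (q u) (param_deriv q u)) (at u)" for u
      unfolding Q fun_cong[OF q] bending_density_deriv_tangential[OF nz]
      using DERIV_mult[OF smooth_has_param_deriv[OF sp(1),
            folded has_real_derivative_iff_has_vector_derivative] density, of u]
      by (simp add: mult.commute add.commute)
    have "\<psi> (0 + 2 * pi) = \<psi> 0" "p (0 + 2 * pi) = p 0" "P (0 + 2 * pi) = P 0"
      using \<psi> x smooth_periodic_param_deriv unfolding P_def p_def smooth_periodic_def
        regular_closed_curve_def by blast+
    then show "\<psi> 0 * bending_density (p 0) (P 0) = \<psi> (2 * pi) * bending_density (p (2 * pi)) (P (2 * pi))"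
      by simp
  qed simp
  then show ?thesis
    using elastic_variation[OF x smooth_scaleR[OF sp(1) p(1)]]
    by (simp flip: p_def P_def q_def)
qed

section \<open>Stationarity and constant speed\<close>

lemma constant_speed_positive:
  "regular_closed_curve x \<Longrightarrow> (\<And>u. speed x u = S) \<Longrightarrow> S > 0"
  unfolding regular_closed_curve_def speed_def by (metis zero_less_norm_iff)

text \<open>At constant speed \<open>S\<close> the first variation of the length is \<open>1 / S\<close> times that of the Dirichlet
  energy; the elastic parts of the two functionals cancel in the difference.\<close>

lemma constant_speed_variation:
  fixes x :: "real \<Rightarrow> real ^ 'n"
  assumes x: "regular_closed_curve x" and S: "\<And>u. speed x u = S" and \<phi>: "smooth \<phi>"
  shows "((\<lambda>\<epsilon>. D_functional l (\<lambda>u. x u + \<epsilon> *\<^sub>R \<phi> u) - E_functional (l * S) (\<lambda>u. x u + \<epsilon> *\<^sub>R \<phi> u))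
    has_real_derivative 0) (at 0)"
proof -
  have sx: "smooth x" using x by (simp add: regular_closed_curve_def smooth_periodic_def)
  have S0: "S > 0" by (rule constant_speed_positive[OF x S])
  let ?I = "integral {0..2 * pi} (\<lambda>u. param_deriv x u \<bullet> param_deriv \<phi> u)"
  have "((\<lambda>\<epsilon>. l * dirichlet_energy (\<lambda>u. x u + \<epsilon> *\<^sub>R \<phi> u)
      - l * S * curve_length (\<lambda>u. x u + \<epsilon> *\<^sub>R \<phi> u)) has_real_derivative
      l * ?I - l * S * (?I / S)) (at 0)"
    using length_variation[OF x \<phi>]
    by (intro DERIV_diff DERIV_cmult dirichlet_variation sx \<phi>) (simp add: S)
  then show ?thesis
    using S0 by (simp add: D_functional_def E_functional_def)
qed

lemma constant_speed_stationary_iff: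
  assumes x: "regular_closed_curve x" and S: "\<And>u. speed x u = S"
  shows "stationary_point (D_functional l) x \<longleftrightarrow> stationary_point (E_functional (l * S)) x"
  unfolding stationary_point_def
proof (intro iff_allI imp_cong refl)
  fix \<phi> :: "real \<Rightarrow> real ^ 'a" assume "smooth_periodic \<phi>"
  then have "smooth \<phi>" by (simp add: smooth_periodic_def)
  note diff = constant_speed_variation[OF x S this, of l]
  show "((\<lambda>\<epsilon>. D_functional l (\<lambda>u. x u + \<epsilon> *\<^sub>R \<phi> u)) has_real_derivative 0) (at 0) \<longleftrightarrow>
    ((\<lambda>\<epsilon>. E_functional (l * S) (\<lambda>u. x u + \<epsilon> *\<^sub>R \<phi> u)) has_real_derivative 0) (at 0)"
    (is "(?D has_real_derivative 0) _ \<longleftrightarrow> (?E has_real_derivative 0) _")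
  proof
    assume "(?D has_real_derivative 0) (at 0)"
    from DERIV_diff[OF this diff] show "(?E has_real_derivative 0) (at 0)" by simp
  next
    assume "(?E has_real_derivative 0) (at 0)"
    from DERIV_add[OF this diff] show "(?D has_real_derivative 0) (at 0)" by simp
  qed
qed

text \<open>The test field is \<open>\<psi> x'\<close> with \<open>\<psi> = (|x'|\<^sup>2)'\<close>. The elastic part of the variation is zero, and the
  Dirichlet part is \<open>- 1/2 \<integral> \<psi>\<^sup>2\<close> up to the integral of the derivative of a periodic function.\<close>

lemma stationary_D_constant_speed:
  fixes x :: "real \<Rightarrow> real ^ 'n"
  assumes x: "regular_closed_curve x" and l: "l > 0" and stat: "stationary_point (D_functional l) x"
  obtains S where "\<And>u. speed x u = S"
proof -
  define p P where "p = param_deriv x" and "P = param_deriv p"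
  define g \<psi> where "g = (\<lambda>u. p u \<bullet> p u)" and "\<psi> = param_deriv g"
  have spx: "smooth_periodic x" using x by (simp add: regular_closed_curve_def)
  then have sx: "smooth x" by (simp add: smooth_periodic_def)
  have p: "smooth_periodic p" unfolding p_def by (rule smooth_periodic_param_deriv[OF spx])
  then have sp: "smooth p" by (simp add: smooth_periodic_def)
  have g: "smooth_periodic g"
    using p by (simp add: g_def smooth_periodic_def smooth_inner)
  have \<psi>: "smooth_periodic \<psi>" unfolding \<psi>_def by (rule smooth_periodic_param_deriv[OF g])
  have sg: "smooth g" "smooth \<psi>" "smooth (param_deriv \<psi>)"
    using g \<psi> smooth_param_deriv by (auto simp: smooth_periodic_def)
  have g': "(g has_vector_derivative \<psi> u) (at u)" for u
    unfolding \<psi>_def by (rule smooth_has_param_deriv[OF sg(1)])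
  have \<psi>_eq: "\<psi> u = 2 * (p u \<bullet> P u)" for u
    using bounded_bilinear.has_vector_derivative[OF bounded_bilinear_inner
        smooth_has_param_deriv[OF sp] smooth_has_param_deriv[OF sp], of u]
    by (auto simp: \<psi>_def P_def g_def inner_commute intro!: param_deriv_eqI)
  let ?\<phi> = "\<lambda>u. \<psi> u *\<^sub>R p u"
  have \<phi>: "smooth_periodic ?\<phi>"
    using \<psi> p by (simp add: smooth_periodic_def smooth_scaleR)
  then have s\<phi>: "smooth ?\<phi>" by (simp add: smooth_periodic_def)
  have "((\<lambda>\<epsilon>. D_functional l (\<lambda>u. x u + \<epsilon> *\<^sub>R ?\<phi> u)) has_real_derivative
      0 + l * integral {0..2 * pi} (\<lambda>u. param_deriv x u \<bullet> param_deriv ?\<phi> u)) (at 0)"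
    unfolding D_functional_def
    using elastic_variation_tangential[OF x \<psi>]
    by (intro DERIV_add DERIV_cmult dirichlet_variation sx s\<phi>) (simp add: p_def)
  moreover have "((\<lambda>\<epsilon>. D_functional l (\<lambda>u. x u + \<epsilon> *\<^sub>R ?\<phi> u)) has_real_derivative 0) (at 0)"
    using stat \<phi> unfolding stationary_point_def by blast
  ultimately have "0 + l * integral {0..2 * pi} (\<lambda>u. param_deriv x u \<bullet> param_deriv ?\<phi> u) = 0"
    by (rule DERIV_unique)
  then have "integral {0..2 * pi} (\<lambda>u. param_deriv x u \<bullet> param_deriv ?\<phi> u) = 0"
    using l by simp
  moreover have "param_deriv x u \<bullet> param_deriv ?\<phi> u = (param_deriv \<psi> u * g u + \<psi> u * \<psi> u) - (\<psi> u)\<^sup>2 / 2" for u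
    unfolding smooth_product_deriv[OF sg(2) sp] p_def[symmetric] P_def[symmetric]
    by (simp add: inner_simps g_def \<psi>_eq power2_eq_square)
  ultimately have 0: "integral {0..2 * pi} (\<lambda>u. (param_deriv \<psi> u * g u + \<psi> u * \<psi> u) - (\<psi> u)\<^sup>2 / 2) = 0"
    by simp
  have "integral {0..2 * pi} (\<lambda>u. param_deriv \<psi> u * g u + \<psi> u * \<psi> u) = 0"
  proof (rule integral_derivative_periodic)
    show "((\<lambda>u. \<psi> u * g u) has_real_derivative param_deriv \<psi> u * g u + \<psi> u * \<psi> u) (at u)" for u
      using DERIV_mult[OF smooth_has_param_deriv[OF sg(2), folded has_real_derivative_iff_has_vector_derivative]
          g'[folded has_real_derivative_iff_has_vector_derivative], of u]
      by (simp add: mult.commute)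
    show "\<psi> 0 * g 0 = \<psi> (2 * pi) * g (2 * pi)"
      using \<psi> g unfolding smooth_periodic_def by (metis add_0)
  qed simp
  moreover have "integral {0..2 * pi} (\<lambda>u. (param_deriv \<psi> u * g u + \<psi> u * \<psi> u) - (\<psi> u)\<^sup>2 / 2) =
      integral {0..2 * pi} (\<lambda>u. param_deriv \<psi> u * g u + \<psi> u * \<psi> u) - integral {0..2 * pi} (\<lambda>u. (\<psi> u)\<^sup>2 / 2)"
    by (intro integral_diff integrable_continuous_real continuous_intros smooth_continuous_on sg) simp
  ultimately have "integral {0..2 * pi} (\<lambda>u. (\<psi> u)\<^sup>2 / 2) = 0"
    using 0 by simp
  moreover have "continuous_on {0..2 * pi} (\<lambda>u. (\<psi> u)\<^sup>2 / 2)"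
    by (intro continuous_intros smooth_continuous_on sg) simp
  ultimately have \<psi>0: "\<psi> u = 0" if "u \<in> {0..2 * pi}" for u
    using integral_eq_0_iff[of 0 "2 * pi" "\<lambda>u. (\<psi> u)\<^sup>2 / 2"] that by auto
  have "\<psi> u = 0" for u
    using periodic_representative[of \<psi> "2 * pi" u] \<psi> \<psi>0 by (auto simp: smooth_periodic_def)
  then have "g u = g 0" for u
    using g' by (intro DERIV_isconst_all) (simp add: has_real_derivative_iff_has_vector_derivative)
  then have "speed x u = sqrt (g 0)" for u
    by (metis g_def norm_eq_sqrt_inner p_def speed_def)
  then show thesis by (rule that)
qed

section \<open>Reparametrization\<close>

text \<open>Orientation-preserving diffeomorphisms of the circle that fix the base point, lifted to the
  line.\<close>

definition circle_lift :: "(real \<Rightarrow> real) \<Rightarrow> bool" where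
  "circle_lift \<theta> \<longleftrightarrow> smooth \<theta> \<and> (\<forall>u. param_deriv \<theta> u > 0) \<and>
    \<theta> 0 = 0 \<and> (\<forall>u. \<theta> (u + 2 * pi) = \<theta> u + 2 * pi)"

lemma constant_speed_reparam_iff:
  "constant_speed_reparam x y S \<longleftrightarrow> (\<exists>\<theta>. circle_lift \<theta> \<and> y = x \<circ> \<theta>) \<and> (\<forall>u. speed y u = S)"
  by (auto simp: constant_speed_reparam_def circle_lift_def)

lemma circle_lift_DERIV:
  "circle_lift \<theta> \<Longrightarrow> (\<theta> has_real_derivative param_deriv \<theta> u) (at u)"
  by (simp add: circle_lift_def has_real_derivative_iff_has_vector_derivative smooth_has_param_deriv)

lemma circle_lift_less_iff:
  assumes "circle_lift \<theta>"
  shows "\<theta> u < \<theta> v \<longleftrightarrow> u < v"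
proof -
  have "\<theta> u < \<theta> v" if "u < v" for u v
  proof (rule DERIV_pos_imp_increasing[OF that])
    show "\<exists>y. (\<theta> has_real_derivative y) (at w) \<and> y > 0" for w
      using circle_lift_DERIV[OF assms] assms unfolding circle_lift_def by blast
  qed
  then show ?thesis by (metis less_asym less_linear)
qed

text \<open>A lift maps each multiple of \<open>2\<pi>\<close> to itself, so the intermediate value theorem applies between
  large multiples.\<close>

lemma circle_lift_surj:
  assumes "circle_lift \<theta>"
  shows "surj \<theta>"
proof -
  interpret periodic_fun_simple "\<lambda>u. \<theta> u - u" "2 * pi"
    using assms by unfold_locales (simp add: circle_lift_def)
  have "\<exists>u. \<theta> u = v" for v
  proof -
    obtain n :: nat where n: "\<bar>v\<bar> / (2 * pi) \<le> of_nat n" using real_arch_simple by blast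
    have \<theta>: "\<theta> (of_int k * (2 * pi)) = of_int k * (2 * pi)" for k
      using plus_of_int[of 0 k] assms by (simp add: circle_lift_def)
    have "\<theta> (- (real n * (2 * pi))) \<le> v" "v \<le> \<theta> (real n * (2 * pi))"
      using n \<theta>[of "int n"] \<theta>[of "- int n"] by (auto simp: pos_divide_le_eq abs_le_iff)
    moreover have "isCont \<theta> u" for u using circle_lift_DERIV[OF assms] by (rule DERIV_isCont)
    ultimately show ?thesis
      using IVT[of \<theta> "- (real n * (2 * pi))" v "real n * (2 * pi)"] by auto
  qed
  then show ?thesis by (metis surjI)
qed

lemma circle_lift_inverse:
  assumes "circle_lift \<theta>"
  obtains \<eta> where "circle_lift \<eta>" "\<And>u. \<theta> (\<eta> u) = u" "\<And>u. \<eta> (\<theta> u) = u"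
    "\<And>u. param_deriv \<eta> u = inverse (param_deriv \<theta> (\<eta> u))"
proof -
  have inj: "inj \<theta>"
    using circle_lift_less_iff[OF assms] by (metis injI linorder_neq_iff)
  define \<eta> where "\<eta> = inv \<theta>"
  have \<theta>\<eta>: "\<theta> (\<eta> u) = u" for u unfolding \<eta>_def by (rule surj_f_inv_f[OF circle_lift_surj[OF assms]])
  have \<eta>\<theta>: "\<eta> (\<theta> u) = u" for u unfolding \<eta>_def by (rule inv_f_f[OF inj])
  have pos: "param_deriv \<theta> u > 0" for u using assms by (simp add: circle_lift_def)
  have "isCont \<eta> (\<theta> (\<eta> u))" for u
    by (rule isCont_inverse_function[of 1, OF _ \<eta>\<theta> DERIV_isCont[OF circle_lift_DERIV[OF assms]]]) simp
  then have cont: "isCont \<eta> u" for u by (simp only: \<theta>\<eta>)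
  have deriv: "(\<eta> has_real_derivative inverse (param_deriv \<theta> (\<eta> u))) (at u)" for u
    by (rule DERIV_inverse_function[OF circle_lift_DERIV[OF assms], of _ _ "u - 1" "u + 1"])
      (use \<theta>\<eta> pos[of "\<eta> u"] cont in simp_all)
  then have pd: "param_deriv \<eta> u = inverse (param_deriv \<theta> (\<eta> u))" for u
    by (auto intro: param_deriv_eqI simp: has_real_derivative_iff_has_vector_derivative)
  have "smooth \<eta>"
    unfolding smooth_iff_times_differentiable
    using times_differentiable_inverse_function[OF deriv] pos assms
    by (metis circle_lift_def less_irrefl)
  moreover have "\<eta> (u + 2 * pi) = \<eta> u + 2 * pi" for u
    using assms \<eta>\<theta> \<theta>\<eta> unfolding circle_lift_def by metis
  moreover have "\<eta> 0 = 0" using \<eta>\<theta>[of 0] assms by (simp add: circle_lift_def)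
  ultimately have "circle_lift \<eta>" using pos by (simp add: circle_lift_def pd)
  then show thesis using \<theta>\<eta> \<eta>\<theta> pd that by blast
qed

lemma circle_lift_2pi: "circle_lift \<theta> \<Longrightarrow> \<theta> (2 * pi) = 2 * pi"
  unfolding circle_lift_def by (metis add_0)

lemma circle_lift_image:
  assumes "circle_lift \<theta>" "u \<in> {0..2 * pi}"
  shows "\<theta> u \<in> {0..2 * pi}"
  using assms circle_lift_less_iff[OF assms(1), of u 0] circle_lift_less_iff[OF assms(1), of "2 * pi" u]
    circle_lift_2pi[OF assms(1)] by (auto simp: circle_lift_def not_less)

lemma integral_circle_lift:
  fixes f :: "real \<Rightarrow> real"
  assumes "circle_lift \<theta>" "continuous_on {0..2 * pi} f"
  shows "integral {0..2 * pi} (\<lambda>u. param_deriv \<theta> u * f (\<theta> u)) = integral {0..2 * pi} f"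
proof -
  have "((\<lambda>u. param_deriv \<theta> u *\<^sub>R f (\<theta> u)) has_integral (integral {\<theta> 0..\<theta> (2 * pi)} f)) {0..2 * pi}"
    using assms circle_lift_image[OF assms(1)] circle_lift_2pi[OF assms(1)] circle_lift_DERIV[OF assms(1)]
    by (intro has_integral_substitution[of _ _ _ 0 "2 * pi"])
      (auto simp: circle_lift_def intro: has_field_derivative_at_within)
  then show ?thesis
    using assms(1) circle_lift_2pi[OF assms(1)] by (simp add: circle_lift_def integral_unique)
qed

lemma param_deriv_circle_lift:
  assumes "circle_lift \<theta>" "f differentiable at (\<theta> u)"
  shows "param_deriv (f \<circ> \<theta>) u = param_deriv \<theta> u *\<^sub>R param_deriv f (\<theta> u)"
  using param_deriv_compose[of \<theta> u f] assms smooth_differentiable[of \<theta> u]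
  by (simp add: circle_lift_def o_def)

lemma speed_circle_lift:
  assumes "circle_lift \<theta>" "smooth x"
  shows "speed (x \<circ> \<theta>) u = param_deriv \<theta> u * speed x (\<theta> u)"
proof -
  have "\<bar>param_deriv \<theta> u\<bar> = param_deriv \<theta> u"
    using assms(1) by (simp add: circle_lift_def abs_of_pos)
  then show ?thesis
    using assms by (simp add: speed_def param_deriv_circle_lift smooth_differentiable)
qed

lemma arc_deriv_circle_lift:
  assumes "circle_lift \<theta>" "smooth x" "f differentiable at (\<theta> u)"
  shows "arc_deriv (x \<circ> \<theta>) (f \<circ> \<theta>) u = arc_deriv x f (\<theta> u)"
proof -
  have "param_deriv \<theta> u \<noteq> 0" using assms(1) by (metis circle_lift_def less_irrefl)
  then show ?thesis
    by (simp add: arc_deriv_def speed_circle_lift[OF assms(1,2)] param_deriv_circle_lift[OF assms(1,3)])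
qed

text \<open>Arc-length derivatives commute with reparametrization. Regularity at \<open>\<theta> u\<close> makes the unit
  tangent differentiable there.\<close>

lemma curvature_circle_lift:
  assumes \<theta>: "circle_lift \<theta>" and x: "smooth x" and nz: "param_deriv x (\<theta> u) \<noteq> 0"
  shows "curvature_vec (x \<circ> \<theta>) u = curvature_vec x (\<theta> u)"
proof -
  have "arc_deriv (x \<circ> \<theta>) (x \<circ> \<theta>) = arc_deriv x x \<circ> \<theta>"
    using arc_deriv_circle_lift[OF \<theta> x smooth_differentiable[OF x]] by auto
  moreover have "arc_deriv x x differentiable at (\<theta> u)"
  proof -
    note d = smooth_has_param_deriv[OF smooth_param_deriv[OF x], of "\<theta> u"]
    have "(\<lambda>u. inverse (norm (param_deriv x u)) *\<^sub>R param_deriv x u) differentiable at (\<theta> u)"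
      by (rule differentiableI_vector,
          rule has_vector_derivative_scaleR[OF DERIV_inverse'[OF has_vector_derivative_norm[OF d nz]] d])
        (use nz in simp)
    then show ?thesis by (simp add: arc_deriv_def[abs_def] speed_def)
  qed
  ultimately show ?thesis
    by (simp add: curvature_vec_def arc_deriv_circle_lift[OF \<theta> x])
qed

text \<open>Regularity makes the elastic integrand continuous, as the substitution rule requires.\<close>

lemma E_functional_circle_lift:
  assumes \<theta>: "circle_lift \<theta>" and x: "smooth x"
    and nz: "\<And>u. u \<in> {0..2 * pi} \<Longrightarrow> param_deriv x u \<noteq> 0"
  shows "E_functional lt (x \<circ> \<theta>) = E_functional lt x"
proof -
  note px = smooth_param_deriv[OF x] smooth_param_deriv[OF smooth_param_deriv[OF x]]
  have "curve_length (x \<circ> \<theta>) = integral {0..2 * pi} (\<lambda>u. param_deriv \<theta> u * speed x (\<theta> u))"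
    unfolding curve_length_def by (intro integral_cong speed_circle_lift \<theta> x)
  also have "\<dots> = curve_length x"
    unfolding curve_length_def
    by (rule integral_circle_lift[OF \<theta>])
      (unfold speed_def[abs_def], intro continuous_on_norm smooth_continuous_on px)
  finally have L: "curve_length (x \<circ> \<theta>) = curve_length x" .
  let ?K = "\<lambda>u. (norm (curvature_vec x u))\<^sup>2 * speed x u"
  have "continuous_on {0..2 * pi} (\<lambda>u. bending_density (param_deriv x u) (param_deriv (param_deriv x) u))"
    unfolding bending_density_def
    by (intro continuous_intros smooth_continuous_on px) (use nz in auto)
  then have cont: "continuous_on {0..2 * pi} ?K"
    by (subst continuous_on_cong[OF refl curvature_density[OF x nz]])
  have "elastic_energy (x \<circ> \<theta>) = 1 / 2 * integral {0..2 * pi} (\<lambda>u. param_deriv \<theta> u * ?K (\<theta> u))"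
    unfolding elastic_energy_def
    by (rule arg_cong[where f = "(*) (1 / 2)"], rule integral_cong)
      (simp add: speed_circle_lift[OF \<theta> x] curvature_circle_lift[OF \<theta> x nz[OF circle_lift_image[OF \<theta>]]])
  also have "\<dots> = elastic_energy x"
    unfolding elastic_energy_def integral_circle_lift[OF \<theta> cont] ..
  finally show ?thesis by (simp add: E_functional_def L)
qed

lemma regular_closed_curve_circle_lift:
  assumes \<theta>: "circle_lift \<theta>" and x: "regular_closed_curve x"
  shows "regular_closed_curve (x \<circ> \<theta>)"
proof -
  have "param_deriv \<theta> u \<noteq> 0" for u using \<theta> by (metis circle_lift_def less_irrefl)
  moreover have s: "smooth x" "smooth \<theta>"
    using \<theta> x by (auto simp: regular_closed_curve_def smooth_periodic_def circle_lift_def)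
  ultimately have "param_deriv (x \<circ> \<theta>) u \<noteq> 0" for u
    using x by (simp add: param_deriv_circle_lift[OF \<theta>] smooth_differentiable regular_closed_curve_def)
  moreover have "smooth (x \<circ> \<theta>)"
    unfolding o_def by (rule smooth_compose[OF s])
  moreover have "(x \<circ> \<theta>) (u + 2 * pi) = (x \<circ> \<theta>) u" for u
    using \<theta> x by (simp add: regular_closed_curve_def smooth_periodic_def circle_lift_def)
  ultimately show ?thesis by (simp add: regular_closed_curve_def smooth_periodic_def)
qed

text \<open>Writing \<open>x \<circ> \<theta> + \<epsilon> \<phi> = (x + \<epsilon> (\<phi> \<circ> \<eta>)) \<circ> \<theta>\<close> with \<open>\<eta>\<close> inverse to \<open>\<theta>\<close> reduces the claim to the
  invariance of the functional, which is available while the perturbed curve is regular, that is,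
  for small \<open>\<epsilon>\<close>.\<close>

lemma stationary_E_circle_lift:
  assumes \<theta>: "circle_lift \<theta>" and x: "regular_closed_curve x"
    and stat: "stationary_point (E_functional lt) x"
  shows "stationary_point (E_functional lt) (x \<circ> \<theta>)"
  unfolding stationary_point_def
proof (intro allI impI)
  fix \<phi> :: "real \<Rightarrow> real ^ 'a" assume \<phi>: "smooth_periodic \<phi>"
  obtain \<eta> where \<eta>: "circle_lift \<eta>" "\<And>u. \<theta> (\<eta> u) = u" "\<And>u. \<eta> (\<theta> u) = u"
    using circle_lift_inverse[OF \<theta>] by metis
  let ?\<phi> = "\<lambda>u. \<phi> (\<eta> u)"
  have sx: "smooth x" using x by (simp add: regular_closed_curve_def smooth_periodic_def)
  have \<phi>': "smooth_periodic ?\<phi>"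
    using \<phi> \<eta>(1) by (auto simp: smooth_periodic_def circle_lift_def intro: smooth_compose)
  then have s\<phi>: "smooth ?\<phi>" by (simp add: smooth_periodic_def)
  obtain \<delta> where \<delta>: "\<delta> > 0" "\<And>\<epsilon> u. \<bar>\<epsilon>\<bar> < \<delta> \<Longrightarrow> u \<in> {0..2 * pi} \<Longrightarrow>
      param_deriv x u + \<epsilon> *\<^sub>R param_deriv ?\<phi> u \<noteq> 0"
    using regular_perturbation[OF x s\<phi>] by blast
  have "((\<lambda>\<epsilon>. E_functional lt (\<lambda>u. x u + \<epsilon> *\<^sub>R ?\<phi> u)) has_real_derivative 0) (at 0)"
    using stat \<phi>' by (simp add: stationary_point_def)
  moreover have "E_functional lt (\<lambda>u. x u + \<epsilon> *\<^sub>R ?\<phi> u) = E_functional lt (\<lambda>u. (x \<circ> \<theta>) u + \<epsilon> *\<^sub>R \<phi> u)"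
    if "\<epsilon> \<in> {-\<delta><..<\<delta>}" for \<epsilon>
  proof -
    have "(\<lambda>u. (x \<circ> \<theta>) u + \<epsilon> *\<^sub>R \<phi> u) = (\<lambda>u. x u + \<epsilon> *\<^sub>R ?\<phi> u) \<circ> \<theta>"
      by (simp add: fun_eq_iff \<eta>(3))
    then show ?thesis
      using that \<delta>(2) E_functional_circle_lift[OF \<theta> smooth_perturbation[OF sx s\<phi>, of \<epsilon>], of lt]
      by (simp only: param_deriv_perturbation[OF sx s\<phi>]) auto
  qed
  ultimately show "((\<lambda>\<epsilon>. E_functional lt (\<lambda>u. (x \<circ> \<theta>) u + \<epsilon> *\<^sub>R \<phi> u)) has_real_derivative 0) (at 0)"
    using \<delta>(1)
    by (auto intro: has_field_derivative_transform_within_open[where S = "{-\<delta><..<\<delta>}"])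
qed

lemma continuous_has_antiderivative:
  fixes f :: "real \<Rightarrow> real"
  assumes f: "continuous_on UNIV f"
  obtains F where "F 0 = 0" "\<And>u. (F has_real_derivative f u) (at u)"
proof -
  define F where "F = (\<lambda>u. integral {0..u} f - integral {u..0} f)"
  have "(F has_real_derivative f u) (at u)" for u
  proof -
    \<comment> \<open>A base point to the left of both \<open>0\<close> and \<open>u\<close> turns the one-sided integrals into a single one.\<close>
    define a where "a = - \<bar>u\<bar> - 1"
    have int: "f integrable_on {c..d}" for c d
      using f by (intro integrable_continuous_real) (rule continuous_on_subset, auto)
    have F: "integral {a..v} f - integral {a..0} f = F v" if "v \<in> {a<..<-a}" for v
    proof (cases "v \<ge> 0")
      case True
      then show ?thesis
        using Henstock_Kurzweil_Integration.integral_combine[of a 0 v f] int that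
        by (cases "v = 0") (auto simp: F_def a_def)
    next
      case False
      then show ?thesis
        using Henstock_Kurzweil_Integration.integral_combine[of a v 0 f] int that
        by (auto simp: F_def)
    qed
    have u: "u \<in> {a<..<-a}" by (auto simp: a_def)
    have "((\<lambda>v. integral {a..v} f) has_real_derivative f u) (at u within {a..-a})"
      using u f by (intro integral_has_real_derivative) (auto intro: continuous_on_subset)
    then have "((\<lambda>v. integral {a..v} f) has_real_derivative f u) (at u)"
      using u by (metis at_within_Icc_at greaterThanLessThan_iff)
    then have "((\<lambda>v. integral {a..v} f - integral {a..0} f) has_real_derivative f u - 0) (at u)"
      by (intro DERIV_diff DERIV_const)
    then have "((\<lambda>v. integral {a..v} f - integral {a..0} f) has_real_derivative f u) (at u)"
      by simp
    then show ?thesis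
      by (rule has_field_derivative_transform_within_open[OF _ open_greaterThanLessThan u F])
  qed
  then show thesis by (rule that[rotated]) (simp add: F_def)
qed

text \<open>The lift is the arc length from the base point divided by the mean speed \<open>S\<close>, which makes it
  advance by \<open>2\<pi>\<close> over a period.\<close>

lemma arclength_lift:
  assumes x: "regular_closed_curve x"
  obtains \<sigma> S where "circle_lift \<sigma>" "S > 0" "\<And>u. param_deriv \<sigma> u = speed x u / S"
proof -
  have sx: "smooth x" and nz: "\<And>u. param_deriv x u \<noteq> 0" and per: "\<And>u. x (u + 2 * pi) = x u"
    using x by (auto simp: regular_closed_curve_def smooth_periodic_def)
  have ss: "smooth (speed x)"
    unfolding speed_def[abs_def] by (intro smooth_norm smooth_param_deriv sx nz)
  have pos: "speed x u > 0" for u using nz by (simp add: speed_def)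
  obtain F where F: "F 0 = 0" "\<And>u. (F has_real_derivative speed x u) (at u)"
    using continuous_has_antiderivative[OF smooth_continuous_on[OF ss]] by blast
  define S where "S = F (2 * pi) / (2 * pi)"
  have "F 0 < F (2 * pi)" by (rule DERIV_pos_imp_increasing) (use F(2) pos in \<open>simp, blast\<close>)
  then have S: "S > 0" by (simp add: S_def F(1))
  have "((\<lambda>u. F (u + 2 * pi) - F u) has_real_derivative 0) (at u)" for u
  proof -
    have "((\<lambda>u. F (u + 2 * pi)) has_real_derivative speed x u) (at u)"
      using DERIV_shift[THEN iffD1, OF F(2)[of "u + 2 * pi"]]
      by (simp add: param_deriv_periodic[OF sx per] speed_def)
    from DERIV_diff[OF this F(2)[of u]] show ?thesis by simp
  qed
  then have "F (u + 2 * pi) - F u = F (0 + 2 * pi) - F 0" for u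
    by (intro DERIV_isconst_all[of "\<lambda>u. F (u + 2 * pi) - F u"]) auto
  then have shift: "F (u + 2 * pi) = F u + 2 * pi * S" for u
    by (simp add: S_def F(1) algebra_simps)
  define \<sigma> where "\<sigma> = (\<lambda>u. F u / S)"
  have deriv: "(\<sigma> has_vector_derivative speed x u / S) (at u)" for u
    unfolding \<sigma>_def using DERIV_cdivide[OF F(2)] by (simp add: has_real_derivative_iff_has_vector_derivative)
  have pd: "param_deriv \<sigma> u = speed x u / S" for u by (rule param_deriv_eqI[OF deriv])
  have "smooth \<sigma>"
    using smooth_antiderivative[OF deriv] smooth_scaleR[OF smooth_const[of "inverse S"] ss]
    by (simp add: divide_inverse mult.commute)
  then have "circle_lift \<sigma>"
    unfolding circle_lift_def
  proof (intro conjI allI)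
    show "param_deriv \<sigma> u > 0" for u using S pos by (simp add: pd)
    show "\<sigma> 0 = 0" by (simp add: \<sigma>_def F(1))
    show "\<sigma> (u + 2 * pi) = \<sigma> u + 2 * pi" for u
      using S by (simp add: \<sigma>_def shift add_divide_distrib)
  qed
  then show thesis using S pd by (rule that)
qed

text \<open>If \<open>x \<circ> \<theta>\<close> has constant speed then \<open>\<sigma> \<circ> \<theta>\<close> is linear, where \<open>\<sigma>\<close> is the normalized arc length;
  being a lift, it is the identity, so \<open>\<theta>\<close> is the inverse of \<open>\<sigma>\<close>.\<close>

lemma constant_speed_reparam_exists_unique:
  assumes x: "regular_closed_curve x"
  shows "\<exists>!y. \<exists>S. constant_speed_reparam x y S"
proof -
  have sx: "smooth x" using x by (simp add: regular_closed_curve_def smooth_periodic_def)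
  obtain \<sigma> S where \<sigma>: "circle_lift \<sigma>" "S > 0" "\<And>u. param_deriv \<sigma> u = speed x u / S"
    using arclength_lift[OF x] by metis
  obtain \<eta> where \<eta>: "circle_lift \<eta>" "\<And>u. \<sigma> (\<eta> u) = u" "\<And>u. \<eta> (\<sigma> u) = u"
    "\<And>u. param_deriv \<eta> u = inverse (param_deriv \<sigma> (\<eta> u))"
    using circle_lift_inverse[OF \<sigma>(1)] by metis
  have "param_deriv \<sigma> u \<noteq> 0" for u using \<sigma>(1) by (metis circle_lift_def less_irrefl)
  then have pos: "speed x u \<noteq> 0" for u by (simp add: \<sigma>(3))
  have "speed (x \<circ> \<eta>) u = S" for u
    using pos \<sigma>(2) by (simp add: speed_circle_lift[OF \<eta>(1) sx] \<eta>(4) \<sigma>(3))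
  then have ex: "constant_speed_reparam x (x \<circ> \<eta>) S"
    using \<eta>(1) by (auto simp: constant_speed_reparam_iff)
  have "\<theta> = \<eta>" if \<theta>: "circle_lift \<theta>" "\<And>u. speed (x \<circ> \<theta>) u = S'" for \<theta> S'
  proof -
    have "((\<lambda>u. \<sigma> (\<theta> u)) has_real_derivative S' / S) (at u)" for u
      using DERIV_chain2[OF circle_lift_DERIV[OF \<sigma>(1)] circle_lift_DERIV[OF \<theta>(1)], of u] \<theta>(2)[of u]
      by (simp add: \<sigma>(3) speed_circle_lift[OF \<theta>(1) sx] mult.commute)
    then have "\<sigma> (\<theta> u) - \<sigma> (\<theta> 0) = (u - 0) * (S' / S)" if "u \<noteq> 0" for u
      using that by (intro DERIV_const_ratio_const) auto
    then have lin: "\<sigma> (\<theta> u) = u * (S' / S)" for u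
      using \<sigma>(1) \<theta>(1) by (cases "u = 0") (auto simp: circle_lift_def)
    have "2 * pi = 2 * pi * (S' / S)"
      using lin[of "2 * pi"] by (simp only: circle_lift_2pi[OF \<sigma>(1)] circle_lift_2pi[OF \<theta>(1)])
    then have "S' / S = 1" by (metis mult_cancel_left1 pi_neq_zero mult_eq_0_iff zero_neq_numeral)
    then have "\<sigma> (\<theta> u) = u" for u using lin by simp
    then show ?thesis using \<eta>(3) by (metis ext)
  qed
  then have "y = x \<circ> \<eta>" if "constant_speed_reparam x y S'" for y S'
    using that unfolding constant_speed_reparam_iff by blast
  with ex show ?thesis by blast
qed

section \<open>Correspondence of the stationary points\<close>

theorem mainTheorem2:
  fixes x :: "real \<Rightarrow> real ^ 'n"
  assumes "regular_closed_curve x"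
  shows "(\<forall>l>0. stationary_point (D_functional l) x \<longrightarrow>
            (\<exists>S>0. (\<forall>u. speed x u = S) \<and> stationary_point (E_functional (l * S)) x)) \<and>
         (\<forall>lt>0. stationary_point (E_functional lt) x \<longrightarrow>
            (\<exists>!y. \<exists>S. constant_speed_reparam x y S) \<and>
            (\<forall>y S. constant_speed_reparam x y S \<longrightarrow>
               S > 0 \<and> stationary_point (D_functional (lt / S)) y))"
proof (intro conjI allI impI)
  fix l :: real assume l: "l > 0" and stat: "stationary_point (D_functional l) x"
  obtain S where S: "\<And>u. speed x u = S"
    using stationary_D_constant_speed[OF assms l stat] by blast
  show "\<exists>S>0. (\<forall>u. speed x u = S) \<and> stationary_point (E_functional (l * S)) x"
    using constant_speed_positive[OF assms S] S stat constant_speed_stationary_iff[OF assms S] by blast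
next
  show "\<exists>!y. \<exists>S. constant_speed_reparam x y S"
    by (rule constant_speed_reparam_exists_unique[OF assms])
next
  fix lt S :: real and y
  assume stat: "stationary_point (E_functional lt) x" and "constant_speed_reparam x y S"
  then obtain \<theta> where \<theta>: "circle_lift \<theta>" "y = x \<circ> \<theta>" and S: "\<And>u. speed y u = S"
    by (auto simp: constant_speed_reparam_iff)
  have y: "regular_closed_curve y"
    unfolding \<theta>(2) by (rule regular_closed_curve_circle_lift[OF \<theta>(1) assms])
  show pos: "S > 0" by (rule constant_speed_positive[OF y S])
  show "stationary_point (D_functional (lt / S)) y"
    using stationary_E_circle_lift[OF \<theta>(1) assms stat] pos
    by (simp add: constant_speed_stationary_iff[OF y S] flip: \<theta>(2))
qed

end
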